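(* Fix positive integers $m$, $p$, $q$ with $p<m$ and $q\le m$. Consider the class $\mathcal{D}$ of all regular two-level $2^{m-p}$ designs $D$ of resolution at least $2q+1$, that is, with $A_1(D)=\cdots=A_{2q}(D)=0$. Let $\gamma_1$ be the set of all main effects and all interactions involving up to $q$ factors, and for $j\ge 2$ let $\gamma_j$ be the set of all $(q-1+j)$-factor interactions (so $2\le j\le m-q+1$). Let $N_j(D)$ be the number of effects in $\gamma_j$ that are aliased in $D$ with effects in $\gamma_1$. Then, within $\mathcal{D}$, sequentially minimizing $N_2(D),N_3(D),\ldots,N_{m-q+1}(D)$ is equivalent to sequentially minimizing $A_{2q+1}(D),A_{2q+2}(D),\ldots,A_m(D)$; that is, a design in $\mathcal{D}$ is selected by the first criterion if and only if it is selected by the second.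
   Context: A regular $2^{m-p}$ design $D$ is an $n\times m$ matrix with entries $\pm1$, $n=2^{m-p}$, whose columns (letters) represent $m$ factors and which is determined by $p$ independent defining words: a defining word is a set of letters such that the entrywise product of the corresponding columns of $D$ is the all-ones column $I$, and the rows of $D$ are exactly the $\pm1$ vectors (each once) for which the product over each of the $p$ independent words is $+1$. The complete set of defining words (including the empty word, corresponding to $I$) has $2^p$ elements. $A_i(D)$ is the number of defining words of length $i$ (containing exactly $i$ letters). For each nonempty set of factors there is a factorial effect: the main effect if the set has one element, and the $i$-factor interaction if it has $i\ge2$ elements; its column in the model matrix is the entrywise product of the columns of $D$ for the factors in the set. Two effects are aliased with each other if their columns are identical. Sequentially minimizing a list of quantities over a class of designs means selecting the designs in the class whose vector of these quantities is smallest in the lexicographic order. *)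

theory Defs
  imports "Jordan_Normal_Form.Matrix"
begin

text \<open>The \<open>m\<close> factors (letters) of a design matrix are its column indices \<open>0, \<dots>, m - 1\<close>;
  words and factorial effects are sets of factors.\<close>

definition effect_column :: "int mat \<Rightarrow> nat set \<Rightarrow> int vec" where
  "effect_column D S = vec (dim_row D) (\<lambda>r. \<Prod>i\<in>S. D $$ (r, i))"

definition defining_word :: "int mat \<Rightarrow> nat set \<Rightarrow> bool" where
  "defining_word D w \<longleftrightarrow>
     w \<subseteq> {..<dim_col D} \<and> effect_column D w = vec (dim_row D) (\<lambda>_. 1)"

text \<open>Words multiply modulo squares of letters, so a product of words consists of the letters
  that occur in an odd number of them.\<close>

definition word_product :: "nat set set \<Rightarrow> nat set" where
  "word_product X = {i. odd (card {w \<in> X. i \<in> w})}"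

definition independent_words :: "nat set set \<Rightarrow> bool" where
  "independent_words W \<longleftrightarrow> (\<forall>X \<subseteq> W. X \<noteq> {} \<longrightarrow> word_product X \<noteq> {})"

text \<open>The bijection expresses that each admissible \<open>\<plusminus>1\<close> vector occurs as exactly one row;
  in particular all entries of \<open>D\<close> are \<open>\<plusminus>1\<close>.\<close>

definition regular_design :: "nat \<Rightarrow> nat \<Rightarrow> int mat \<Rightarrow> bool" where
  "regular_design m p D \<longleftrightarrow>
     D \<in> carrier_mat (2 ^ (m - p)) m \<and>
     (\<exists>W. W \<subseteq> Pow {..<m} \<and> card W = p \<and> independent_words W \<and>
        bij_betw (row D) {..<2 ^ (m - p)}
          {v \<in> carrier_vec m.
             (\<forall>i<m. v $ i \<in> {-1, 1}) \<and> (\<forall>w\<in>W. (\<Prod>i\<in>w. v $ i) = 1)})"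

definition word_count :: "int mat \<Rightarrow> nat \<Rightarrow> nat" where
  "word_count D i = card {w. defining_word D w \<and> card w = i}"

definition resolution_class :: "nat \<Rightarrow> nat \<Rightarrow> nat \<Rightarrow> int mat set" where
  "resolution_class m p q =
     {D. regular_design m p D \<and> (\<forall>i\<in>{1..2 * q}. word_count D i = 0)}"

definition effects :: "nat \<Rightarrow> nat set set" where
  "effects m = {S. S \<subseteq> {..<m} \<and> S \<noteq> {}}"

definition effect_group :: "nat \<Rightarrow> nat \<Rightarrow> nat \<Rightarrow> nat set set" where
  "effect_group m q j =
     (if j = 1 then {S \<in> effects m. card S \<le> q}
      else {S \<in> effects m. card S = q - 1 + j})"

definition aliased :: "int mat \<Rightarrow> nat set \<Rightarrow> nat set \<Rightarrow> bool" where
  "aliased D S T \<longleftrightarrow> effect_column D S = effect_column D T"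

definition alias_count :: "nat \<Rightarrow> int mat \<Rightarrow> nat \<Rightarrow> nat" where
  "alias_count q D j =
     card {S \<in> effect_group (dim_col D) q j.
             \<exists>T \<in> effect_group (dim_col D) q 1. aliased D S T}"

definition sequential_minimizers :: "('a \<Rightarrow> nat list) \<Rightarrow> 'a set \<Rightarrow> 'a set" where
  "sequential_minimizers f C = {D \<in> C. \<forall>D' \<in> C. ord_class.lexordp_eq (f D) (f D')}"

end

theory Submission imports Defs begin

text \<open>Multiplying words is taking symmetric differences, so two effects \<open>S\<close> and \<open>T\<close> of a design with
  entries \<open>\<plusminus>1\<close> are aliased iff \<open>sym_diff S T\<close> is a defining word. When the resolution exceeds \<open>2 * q\<close>,
  an effect is aliased with at most one set of at most \<open>q\<close> factors, since two such sets would differ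
  by a defining word of length at most \<open>2 * q\<close>. Hence the effects of size \<open>s > q\<close> that are aliased
  with low-order effects correspond one-to-one to the pairs of a defining word \<open>w\<close> and a low-order
  effect \<open>T\<close> such that \<open>sym_diff w T\<close> has size \<open>s\<close> (\<open>alias_count_eq_sum_words\<close>). By symmetry, the
  number of suitable \<open>T\<close> depends only on the length of \<open>w\<close>, so each \<open>N\<^sub>j\<close> is a linear combination of the
  \<open>A\<^sub>i\<close> whose coefficients do not depend on the design (\<open>alias_count_eq_sum_lengths\<close>).

  Multiplying by at most \<open>q\<close> letters shortens a word by at most \<open>q\<close>. With \<open>s = q - 1 + j\<close>, only
  words of length at most \<open>2 * q - 1 + j\<close> contribute to \<open>N\<^sub>j\<close>, and those of length exactly
  \<open>2 * q - 1 + j\<close> do contribute, by cancelling \<open>q\<close> of their letters. The linear system is thus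
  triangular with positive diagonal: the first place at which the word lengths of two designs
  differ is the first place at which their alias counts differ, \<open>2 * q - 1\<close> positions earlier, and
  with the same sign (\<open>lexordp_eq_triangular\<close>). The two criteria compare any two designs alike. The
  alias counts beyond the triangular part never matter, because all of them are determined
  by the word lengths.\<close>

section \<open>Lexicographic comparison under a triangular linear map\<close>

lemma lexordp_eq_map_first_difference:
  fixes f g :: "nat \<Rightarrow> nat"
  assumes "a \<le> k" "k < b" "\<And>i. a \<le> i \<Longrightarrow> i < k \<Longrightarrow> f i = g i" "f k \<noteq> g k"
  shows "ord_class.lexordp_eq (map f [a..<b]) (map g [a..<b]) \<longleftrightarrow> f k < g k"
proof -
  have split: "[a..<b] = [a..<k] @ k # [Suc k..<b]"
    using upt_add_eq_append[OF assms(1), of "b - k"] assms(2) by (simp add: upt_conv_Cons)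
  have prefix: "map f [a..<k] = map g [a..<k]"
    using assms(3) by simp
  have append: "ord_class.lexordp_eq (xs @ ys) (xs @ zs) = ord_class.lexordp_eq ys zs"
    for xs ys zs :: "nat list"
    by (induction xs) auto
  show ?thesis
    unfolding split map_append prefix append using assms(4) by auto
qed

text \<open>The entry of \<open>c\<close> at \<open>(j + d, j)\<close> is the diagonal of the system. Row \<open>j\<close> involves no later
  unknown, so the rows before the first differing unknown agree, and in its own row that unknown
  occurs with positive weight.\<close>

lemma lexordp_eq_triangular:
  fixes a b :: "nat \<Rightarrow> nat" and c :: "nat \<Rightarrow> nat \<Rightarrow> nat" and d e u v :: nat
  assumes upper: "\<And>i j. j + d < i \<Longrightarrow> c i j = 0"
    and diagonal: "\<And>j. 0 < c (j + d) j"
    and "u \<le> v + d"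
  defines "F \<equiv> \<lambda>x j. \<Sum>i\<in>{e + d..<u}. x i * c i j"
  shows "ord_class.lexordp_eq (map (F a) [e..<v]) (map (F b) [e..<v]) \<longleftrightarrow>
         ord_class.lexordp_eq (map a [e + d..<u]) (map b [e + d..<u])"
proof (cases "\<exists>i. i \<in> {e + d..<u} \<and> a i \<noteq> b i")
  case False
  then have eq: "a i = b i" if "i \<in> {e + d..<u}" for i
    using that by blast
  have "F a = F b"
    unfolding F_def using eq by (intro ext sum.cong) simp_all
  moreover have "map a [e + d..<u] = map b [e + d..<u]"
    using eq by simp
  ultimately show ?thesis
    by (simp only: lexordp_eq_refl)
next
  case True
  define k where "k = (LEAST i. i \<in> {e + d..<u} \<and> a i \<noteq> b i)"
  have k: "e + d \<le> k" "k < u" "a k \<noteq> b k"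
    using LeastI_ex[OF True] by (auto simp: k_def)
  have agree: "a i = b i" if "e + d \<le> i" "i < k" for i
    using not_less_Least[of i "\<lambda>i. i \<in> {e + d..<u} \<and> a i \<noteq> b i"] that k(2) by (auto simp: k_def)
  have before: "F a j = F b j" if "j + d < k" for j
    unfolding F_def
  proof (rule sum.cong[OF refl])
    fix i assume "i \<in> {e + d..<u}"
    then show "a i * c i j = b i * c i j"
      using agree[of i] upper[of j i] that by (cases "i < k") auto
  qed
  define rest where "rest = (\<Sum>i\<in>{e + d..<u} - {k}. a i * c i (k - d))"
  have a_row: "F a (k - d) = a k * c k (k - d) + rest"
    unfolding F_def rest_def using k by (intro sum.remove) auto
  have "F b (k - d) = b k * c k (k - d) + (\<Sum>i\<in>{e + d..<u} - {k}. b i * c i (k - d))"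
    unfolding F_def using k by (intro sum.remove) auto
  also have "(\<Sum>i\<in>{e + d..<u} - {k}. b i * c i (k - d)) = rest"
    unfolding rest_def
  proof (rule sum.cong[OF refl])
    fix i assume "i \<in> {e + d..<u} - {k}"
    then show "b i * c i (k - d) = a i * c i (k - d)"
      using agree[of i] upper[of "k - d" i] k by (cases "i < k") auto
  qed
  finally have b_row: "F b (k - d) = b k * c k (k - d) + rest" .
  have "0 < c k (k - d)"
    using diagonal[of "k - d"] k by simp
  then have less: "F a (k - d) < F b (k - d) \<longleftrightarrow> a k < b k"
    and neq: "F a (k - d) \<noteq> F b (k - d)"
    using a_row b_row k(3) by auto
  have "ord_class.lexordp_eq (map (F a) [e..<v]) (map (F b) [e..<v]) \<longleftrightarrow> F a (k - d) < F b (k - d)"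
    using k assms(3) before neq by (intro lexordp_eq_map_first_difference) auto
  moreover have "ord_class.lexordp_eq (map a [e + d..<u]) (map b [e + d..<u]) \<longleftrightarrow> a k < b k"
    using k agree by (intro lexordp_eq_map_first_difference) auto
  ultimately show ?thesis
    using less by simp
qed

section \<open>Aliasing and defining words\<close>

lemma prod_sym_diff:
  fixes x :: "'a \<Rightarrow> int"
  assumes "finite S" "finite T" "\<And>i. i \<in> S \<inter> T \<Longrightarrow> x i \<in> {-1, 1}"
  shows "prod x (sym_diff S T) = prod x S * prod x T"
proof -
  have square: "prod x (S \<inter> T) * prod x (S \<inter> T) = 1"
    using assms(3) by (subst prod.distrib[symmetric], intro prod.neutral) fastforce
  have "prod x S = prod x (S - T) * prod x (S \<inter> T)"
    using prod.Int_Diff[OF assms(1), of x T] by (simp add: mult.commute)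
  moreover have "prod x T = prod x (T - S) * prod x (S \<inter> T)"
    using prod.Int_Diff[OF assms(2), of x S] by (simp add: mult.commute Int_commute)
  ultimately have "prod x S * prod x T
      = prod x (S - T) * prod x (T - S) * (prod x (S \<inter> T) * prod x (S \<inter> T))"
    by (simp only: mult.assoc mult.commute mult.left_commute)
  also have "\<dots> = prod x (sym_diff S T)"
    unfolding square using assms(1,2) by (subst prod.union_disjoint) auto
  finally show ?thesis ..
qed

lemma regular_design_dim_col: "regular_design m p D \<Longrightarrow> dim_col D = m"
  by (auto simp: regular_design_def)

lemma regular_design_entry:
  assumes "regular_design m p D" "r < dim_row D" "i < m"
  shows "D $$ (r, i) \<in> {-1, 1}"
proof -
  obtain W where dims: "D \<in> carrier_mat (2 ^ (m - p)) m"
    and bij: "bij_betw (row D) {..<2 ^ (m - p)}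
          {v \<in> carrier_vec m.
             (\<forall>i<m. v $ i \<in> {-1, 1}) \<and> (\<forall>w\<in>W. (\<Prod>i\<in>w. v $ i) = (1 :: int))}"
    using assms(1) unfolding regular_design_def by blast
  have "r \<in> {..<2 ^ (m - p)}"
    using dims assms(2) by auto
  from bij_betwE[OF bij, rule_format, OF this] have "row D r $ i \<in> {-1, 1}"
    using assms(3) by blast
  then show ?thesis
    using dims assms(2,3) by auto
qed

text \<open>Signs are their own inverses, so two of them agree iff their product is 1.\<close>

lemma aliased_iff_defining_word:
  assumes "regular_design m p D" "S \<subseteq> {..<m}" "T \<subseteq> {..<m}"
  shows "aliased D S T \<longleftrightarrow> defining_word D (sym_diff S T)"
proof -
  have "(\<Prod>i\<in>S. D $$ (r, i)) = (\<Prod>i\<in>T. D $$ (r, i)) \<longleftrightarrow> (\<Prod>i\<in>sym_diff S T. D $$ (r, i)) = 1"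
    if r: "r < dim_row D" for r
  proof -
    have sign: "(\<Prod>i\<in>U. D $$ (r, i)) \<in> {-1, 1}" if "U \<subseteq> {..<m}" for U
      using finite_subset[OF that finite_lessThan] that
    proof (induction U rule: finite_induct)
      case (insert i U)
      then have "D $$ (r, i) \<in> {-1, 1}"
        using regular_design_entry[OF assms(1) r] by auto
      then show ?case
        using insert by auto
    qed auto
    have "(\<Prod>i\<in>sym_diff S T. D $$ (r, i)) = (\<Prod>i\<in>S. D $$ (r, i)) * (\<Prod>i\<in>T. D $$ (r, i))"
      using assms regular_design_entry[OF assms(1) r]
      by (intro prod_sym_diff) (auto intro: finite_subset)
    then show ?thesis
      using sign[OF assms(2)] sign[OF assms(3)] by auto
  qed
  moreover have "sym_diff S T \<subseteq> {..<dim_col D}"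
    using assms regular_design_dim_col by auto
  ultimately show ?thesis
    by (auto simp: aliased_def defining_word_def effect_column_def vec_eq_iff)
qed

lemma finite_defining_words: "finite {w. defining_word D w}"
  by (rule finite_subset[of _ "Pow {..<dim_col D}"]) (auto simp: defining_word_def)

text \<open>The empty word has to be excepted: it has length 0, and a resolution constrains only positive
  lengths.\<close>

lemma short_defining_word_empty:
  assumes "D \<in> resolution_class m p q" "defining_word D w" "card w \<le> 2 * q"
  shows "w = {}"
proof (rule ccontr)
  assume "w \<noteq> {}"
  moreover have "finite w"
    using assms(2) by (auto simp: defining_word_def intro: finite_subset)
  ultimately have "card w \<in> {1..2 * q}"
    using assms(3) by (simp add: Suc_le_eq card_gt_0_iff)
  then have "card {v. defining_word D v \<and> card v = card w} = 0"
    using assms(1) by (auto simp: resolution_class_def word_count_def)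
  moreover have "finite {v. defining_word D v \<and> card v = card w}"
    using finite_defining_words by (rule rev_finite_subset) auto
  ultimately show False
    using assms(2) by auto
qed

section \<open>Alias counts as linear functions of the word counts\<close>

lemma card_sym_diff_le:
  assumes "finite S" "finite T"
  shows "card (sym_diff S T) \<le> card S + card T"
proof -
  have "card (sym_diff S T) \<le> card (S \<union> T)"
    using assms by (intro card_mono) auto
  also have "\<dots> \<le> card S + card T"
    by (rule card_Un_le)
  finally show ?thesis .
qed

lemma card_le_card_sym_diff:
  assumes "finite S" "finite T"
  shows "card S \<le> card (sym_diff S T) + card T"
proof -
  have "sym_diff (sym_diff S T) T = S"
    by auto
  then show ?thesis
    using card_sym_diff_le[of "sym_diff S T" T] assms by simp
qed

lemma effect_group_1_D:
  assumes "T \<in> effect_group m q 1"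
  shows "T \<subseteq> {..<m}" "finite T" "T \<noteq> {}" "card T \<le> q"
  using assms by (auto simp: effect_group_def effects_def intro: finite_subset)

text \<open>The map sending a pair \<open>(w, T)\<close> to \<open>sym_diff w T\<close> is onto the aliased effects because
  \<open>sym_diff S T\<close> is a defining word whenever \<open>S\<close> and \<open>T\<close> are aliased. It is injective because the
  resolution rules out two different low-order effects that are aliased with the same effect.\<close>

lemma alias_count_eq_sum_words:
  assumes D: "D \<in> resolution_class m p q" and j: "2 \<le> j"
  shows "alias_count q D j =
    (\<Sum>w | defining_word D w. card {T \<in> effect_group m q 1. card (sym_diff w T) = q - 1 + j})"
proof -
  have reg: "regular_design m p D"
    using D by (simp add: resolution_class_def)
  note col = regular_design_dim_col[OF reg]
  define words where "words = {w. defining_word D w}"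
  define low where "low w = {T \<in> effect_group m q 1. card (sym_diff w T) = q - 1 + j}" for w
  have words_subset: "w \<subseteq> {..<m}" if "w \<in> words" for w
    using that col by (auto simp: words_def defining_word_def)
  have cancel: "sym_diff (sym_diff A B) B = A" for A B :: "nat set"
    by auto
  have word_aliased: "aliased D (sym_diff w T) T" if "w \<in> words" "T \<in> effect_group m q 1" for w T
  proof -
    have "sym_diff w T \<subseteq> {..<m}"
      using words_subset[OF that(1)] effect_group_1_D(1)[OF that(2)] by auto
    then show ?thesis
      using aliased_iff_defining_word[OF reg _ effect_group_1_D(1)[OF that(2)]] that(1) cancel
      by (simp add: words_def)
  qed
  have "bij_betw (\<lambda>(w, T). sym_diff w T) (Sigma words low)
      {S \<in> effect_group m q j. \<exists>T \<in> effect_group m q 1. aliased D S T}"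
    unfolding bij_betw_def
  proof
    show "inj_on (\<lambda>(w, T). sym_diff w T) (Sigma words low)"
    proof (rule inj_onI, clarsimp simp only: mem_Sigma_iff split_conv prod.inject)
      fix w T w' T'
      assume wT: "w \<in> words" "T \<in> low w" "w' \<in> words" "T' \<in> low w'"
        and eq: "sym_diff w T = sym_diff w' T'"
      then have T: "T \<in> effect_group m q 1" "T' \<in> effect_group m q 1"
        by (auto simp: low_def)
      have "aliased D T T'"
        using word_aliased[OF wT(1) T(1)] word_aliased[OF wT(3) T(2)] eq by (simp add: aliased_def)
      then have "defining_word D (sym_diff T T')"
        using aliased_iff_defining_word[OF reg] T[THEN effect_group_1_D(1)] by blast
      moreover have "card (sym_diff T T') \<le> 2 * q"
        using card_sym_diff_le[of T T'] T[THEN effect_group_1_D(2)] T[THEN effect_group_1_D(4)]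
        by simp
      ultimately have "sym_diff T T' = {}"
        by (rule short_defining_word_empty[OF D])
      then have "T = T'"
        by auto
      then show "w = w' \<and> T = T'"
        using eq by (metis cancel)
    qed
    show "(\<lambda>(w, T). sym_diff w T) ` Sigma words low =
      {S \<in> effect_group m q j. \<exists>T \<in> effect_group m q 1. aliased D S T}"
    proof (intro equalityI subsetI)
      fix S assume "S \<in> (\<lambda>(w, T). sym_diff w T) ` Sigma words low"
      then obtain w T where S: "S = sym_diff w T" "w \<in> words" "T \<in> effect_group m q 1"
        and size: "card S = q - 1 + j"
        by (auto simp: low_def)
      have "S \<subseteq> {..<m}"
        using S words_subset effect_group_1_D(1) by blast
      moreover have "S \<noteq> {}"
        using size j by auto
      ultimately have "S \<in> effect_group m q j"
        using size j by (simp add: effect_group_def effects_def)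
      then show "S \<in> {S \<in> effect_group m q j. \<exists>T \<in> effect_group m q 1. aliased D S T}"
        using word_aliased S by blast
    next
      fix S assume "S \<in> {S \<in> effect_group m q j. \<exists>T \<in> effect_group m q 1. aliased D S T}"
      then obtain T where S: "S \<in> effect_group m q j" and T: "T \<in> effect_group m q 1"
        and al: "aliased D S T"
        by auto
      have S': "S \<subseteq> {..<m}" "card S = q - 1 + j"
        using S j by (auto simp: effect_group_def effects_def split: if_splits)
      have "sym_diff S T \<in> words"
        using aliased_iff_defining_word[OF reg S'(1) effect_group_1_D(1)[OF T]] al
        by (simp add: words_def)
      moreover have "T \<in> low (sym_diff S T)"
        using T S'(2) cancel[of S T] by (simp add: low_def)
      ultimately have "(sym_diff S T, T) \<in> Sigma words low"
        by (rule SigmaI)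
      moreover have "S = (\<lambda>(w, T). sym_diff w T) (sym_diff S T, T)"
        by (simp only: split_conv cancel)
      ultimately show "S \<in> (\<lambda>(w, T). sym_diff w T) ` Sigma words low"
        by (rule rev_image_eqI)
    qed
  qed
  then have "alias_count q D j = card (Sigma words low)"
    unfolding alias_count_def col by (rule bij_betw_same_card[symmetric])
  also have "\<dots> = (\<Sum>w\<in>words. card (low w))"
  proof (rule card_SigmaI)
    show "finite words"
      unfolding words_def by (rule finite_defining_words)
    have "low w \<subseteq> Pow {..<m}" for w
      unfolding low_def using effect_group_1_D(1) by blast
    then show "\<forall>w\<in>words. finite (low w)"
      by (meson finite_Pow_iff finite_lessThan finite_subset)
  qed
  finally show ?thesis
    by (simp add: words_def low_def)
qed

text \<open>The initial segment \<open>{..<i}\<close> stands for an arbitrary word of length \<open>i\<close>.\<close>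

definition alias_multiplicity :: "nat \<Rightarrow> nat \<Rightarrow> nat \<Rightarrow> nat \<Rightarrow> nat" where
  "alias_multiplicity m q i s = card {T \<in> effect_group m q 1. card (sym_diff {..<i} T) = s}"

text \<open>A permutation of the letters that maps \<open>w\<close> to an initial segment acts on the low-order
  effects and preserves all sizes.\<close>

lemma card_eq_alias_multiplicity:
  assumes w: "w \<subseteq> {..<m}"
  shows "card {T \<in> effect_group m q 1. card (sym_diff w T) = s} = alias_multiplicity m q (card w) s"
proof -
  have fin: "finite w"
    using w by (rule finite_subset) simp
  have le: "card w \<le> m"
    using card_mono[OF _ w] by simp
  obtain f where f: "bij_betw f w {..<card w}"
    using fin by (metis card_lessThan finite_lessThan finite_same_card_bij)
  have "card ({..<m} - w) = card ({..<m} - {..<card w})"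
    using w le fin by (simp add: card_Diff_subset)
  then obtain g where g: "bij_betw g ({..<m} - w) ({..<m} - {..<card w})"
    by (metis finite_Diff finite_lessThan finite_same_card_bij)
  define h where "h x = (if x \<in> w then f x else g x)" for x
  have hw: "h ` w = {..<card w}"
    using f by (auto simp: h_def bij_betw_def)
  have "bij_betw h w {..<card w}"
    using f by (rule bij_betw_cong[THEN iffD1, rotated]) (simp add: h_def)
  moreover have "bij_betw h ({..<m} - w) ({..<m} - {..<card w})"
    using g by (rule bij_betw_cong[THEN iffD1, rotated]) (simp add: h_def)
  ultimately have "bij_betw h (w \<union> ({..<m} - w)) ({..<card w} \<union> ({..<m} - {..<card w}))"
    by (rule bij_betw_combine) auto
  moreover have "w \<union> ({..<m} - w) = {..<m}" "{..<card w} \<union> ({..<m} - {..<card w}) = {..<m}"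
    using w le by auto
  ultimately have h: "bij_betw h {..<m} {..<m}"
    by simp
  then have inj: "inj_on h {..<m}"
    by (simp add: bij_betw_def)
  have size: "card (h ` U) = card U" if "U \<subseteq> {..<m}" for U
    using inj that by (meson card_image inj_on_subset)
  have diff: "card (sym_diff {..<card w} (h ` T)) = card (sym_diff w T)" if "T \<subseteq> {..<m}" for T
  proof -
    have "sym_diff {..<card w} (h ` T) = h ` sym_diff w T"
      unfolding hw[symmetric] image_Un
      using inj_on_image_set_diff[OF inj, of w T] inj_on_image_set_diff[OF inj, of T w] w that
      by (metis Diff_subset subset_trans)
    then show ?thesis
      using size[of "sym_diff w T"] w that by auto
  qed
  have group: "h ` T \<in> effect_group m q 1 \<longleftrightarrow> T \<in> effect_group m q 1" if "T \<subseteq> {..<m}" for T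
    using that size[OF that] bij_betw_imp_surj_on[OF h]
    by (auto simp: effect_group_def effects_def)
  have pow: "bij_betw ((`) h) (Pow {..<m}) (Pow {..<m})"
    using h by (rule bij_betw_Pow)
  have "bij_betw ((`) h) {T \<in> effect_group m q 1. card (sym_diff w T) = s}
      {T \<in> effect_group m q 1. card (sym_diff {..<card w} T) = s}"
  proof (rule bij_betw_subset[OF pow])
    show "{T \<in> effect_group m q 1. card (sym_diff w T) = s} \<subseteq> Pow {..<m}"
      using effect_group_1_D(1) by auto
    show "(`) h ` {T \<in> effect_group m q 1. card (sym_diff w T) = s} =
      {T \<in> effect_group m q 1. card (sym_diff {..<card w} T) = s}"
    proof (intro equalityI subsetI)
      fix U assume "U \<in> (`) h ` {T \<in> effect_group m q 1. card (sym_diff w T) = s}"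
      then obtain T where "U = h ` T" "T \<in> effect_group m q 1" "card (sym_diff w T) = s"
        by blast
      then show "U \<in> {T \<in> effect_group m q 1. card (sym_diff {..<card w} T) = s}"
        using diff[of T] group[of T] effect_group_1_D(1)[of T] by simp
    next
      fix U assume U: "U \<in> {T \<in> effect_group m q 1. card (sym_diff {..<card w} T) = s}"
      then have "U \<in> Pow {..<m}"
        using effect_group_1_D(1) by auto
      then obtain T where "U = h ` T" "T \<subseteq> {..<m}"
        using bij_betw_imp_surj_on[OF pow] by (metis PowD imageE)
      then show "U \<in> (`) h ` {T \<in> effect_group m q 1. card (sym_diff w T) = s}"
        using U diff[of T] group[of T] by simp
    qed
  qed
  then show ?thesis
    unfolding alias_multiplicity_def by (rule bij_betw_same_card)
qed

lemma alias_multiplicity_long: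
  assumes "s + q < i"
  shows "alias_multiplicity m q i s = 0"
proof -
  have "card (sym_diff {..<i} T) \<noteq> s" if "T \<in> effect_group m q 1" for T
    using card_le_card_sym_diff[of "{..<i}" T] effect_group_1_D(2,4)[OF that] assms by auto
  then show ?thesis
    unfolding alias_multiplicity_def by (metis (mono_tags, lifting) card.empty empty_Collect_eq)
qed

text \<open>The empty word only relates an effect to itself, so it aliases no effect of more than \<open>q\<close>
  factors with a low-order one.\<close>

lemma alias_multiplicity_empty_word:
  assumes "q < s"
  shows "alias_multiplicity m q 0 s = 0"
proof -
  have "{T \<in> effect_group m q 1. card (sym_diff {..<0} T) = s} = {}"
    using effect_group_1_D(4) assms by fastforce
  then show ?thesis
    unfolding alias_multiplicity_def by (simp only: card.empty)
qed

text \<open>Witness: the effect consisting of \<open>q\<close> letters of the word, which all cancel.\<close>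

lemma alias_multiplicity_diagonal:
  assumes "0 < q" "q \<le> m"
  shows "0 < alias_multiplicity m q (s + q) s"
proof -
  have "sym_diff {..<s + q} {..<q} = {q..<s + q}"
    by auto
  then have "{..<q} \<in> {T \<in> effect_group m q 1. card (sym_diff {..<s + q} T) = s}"
    using assms by (auto simp: effect_group_def effects_def)
  moreover have "finite {T \<in> effect_group m q 1. card (sym_diff {..<s + q} T) = s}"
    by (rule finite_subset[of _ "Pow {..<m}"]) (use effect_group_1_D(1) in auto)
  ultimately show ?thesis
    unfolding alias_multiplicity_def card_gt_0_iff by blast
qed

lemma alias_count_eq_sum_lengths:
  assumes D: "D \<in> resolution_class m p q" and j: "2 \<le> j" and q: "0 < q"
  shows "alias_count q D j =
    (\<Sum>i\<in>{2 * q + 1..<m + 1}. word_count D i * alias_multiplicity m q i (q - 1 + j))"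
proof -
  have reg: "regular_design m p D"
    using D by (simp add: resolution_class_def)
  define words where "words = {w. defining_word D w}"
  define mult where "mult i = alias_multiplicity m q i (q - 1 + j)" for i
  have fin: "finite words"
    unfolding words_def by (rule finite_defining_words)
  have sub: "w \<subseteq> {..<m}" if "w \<in> words" for w
    using that regular_design_dim_col[OF reg] by (auto simp: words_def defining_word_def)
  have "alias_count q D j = (\<Sum>w\<in>words. mult (card w))"
    unfolding alias_count_eq_sum_words[OF D j] mult_def words_def[symmetric]
    using sub card_eq_alias_multiplicity by (intro sum.cong) auto
  also have "\<dots> = (\<Sum>i\<in>{..<m + 1}. \<Sum>w\<in>{w \<in> words. card w = i}. mult (card w))"
  proof (rule sum.group[symmetric, OF fin])
    show "card ` words \<subseteq> {..<m + 1}"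
      using sub card_mono[OF finite_lessThan, of _ m] by (auto simp: less_Suc_eq_le)
  qed simp
  also have "\<dots> = (\<Sum>i\<in>{..<m + 1}. word_count D i * mult i)"
    by (intro sum.cong) (auto simp: word_count_def words_def)
  also have "\<dots> = (\<Sum>i\<in>{2 * q + 1..<m + 1}. word_count D i * mult i)"
  proof (rule sum.mono_neutral_right)
    show "\<forall>i\<in>{..<m + 1} - {2 * q + 1..<m + 1}. word_count D i * mult i = 0"
    proof
      fix i assume "i \<in> {..<m + 1} - {2 * q + 1..<m + 1}"
      then consider "i = 0" | "i \<in> {1..2 * q}"
        by fastforce
      then show "word_count D i * mult i = 0"
      proof cases
        case 1
        then show ?thesis
          using alias_multiplicity_empty_word[of q "q - 1 + j" m] q j by (simp add: mult_def)
      next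
        case 2
        then show ?thesis
          using D by (simp add: resolution_class_def)
      qed
    qed
  qed auto
  finally show ?thesis
    by (simp add: mult_def)
qed

section \<open>Equivalence of the two criteria\<close>

theorem theorem1:
  fixes m p q :: nat
  assumes "0 < p" and "p < m" and "0 < q" and "q \<le> m"
  shows "sequential_minimizers (\<lambda>D. map (alias_count q D) [2..<m - q + 2]) (resolution_class m p q) =
         sequential_minimizers (\<lambda>D. map (word_count D) [2 * q + 1..<m + 1]) (resolution_class m p q)"
proof -
  let ?C = "resolution_class m p q"
  \<comment> \<open>Effects in group \<open>j\<close> have \<open>q - 1 + j\<close> factors, so lengths reach up to
    \<open>q - 1 + j + q\<close>: the diagonal has offset \<open>2 * q - 1\<close>.\<close>
  define c where "c i j = alias_multiplicity m q i (q - 1 + j)" for i j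
  define F where "F x j = (\<Sum>i\<in>{2 + (2 * q - 1)..<m + 1}. x i * c i j)" for x :: "nat \<Rightarrow> nat" and j
  have start: "2 + (2 * q - 1) = 2 * q + 1"
    using assms(3) by simp
  have counts: "map (alias_count q D) [2..<m - q + 2] = map (F (word_count D)) [2..<m - q + 2]"
    if "D \<in> ?C" for D
    using alias_count_eq_sum_lengths[OF that _ assms(3)]
    unfolding F_def c_def start by (intro map_cong) auto
  have order: "ord_class.lexordp_eq (map (F a) [2..<m - q + 2]) (map (F b) [2..<m - q + 2]) \<longleftrightarrow>
      ord_class.lexordp_eq (map a [2 * q + 1..<m + 1]) (map b [2 * q + 1..<m + 1])" for a b
    unfolding F_def start[symmetric]
  proof (rule lexordp_eq_triangular)
    show "c i j = 0" if "j + (2 * q - 1) < i" for i j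
      unfolding c_def using that assms(3) by (intro alias_multiplicity_long) simp
    show "0 < c (j + (2 * q - 1)) j" for j
    proof -
      have "j + (2 * q - 1) = q - 1 + j + q"
        using assms(3) by simp
      then show ?thesis
        unfolding c_def using alias_multiplicity_diagonal[OF assms(3,4)] by metis
    qed
    show "m + 1 \<le> m - q + 2 + (2 * q - 1)"
      using assms(3,4) by simp
  qed
  have "ord_class.lexordp_eq (map (alias_count q D) [2..<m - q + 2])
        (map (alias_count q D') [2..<m - q + 2]) \<longleftrightarrow>
      ord_class.lexordp_eq (map (word_count D) [2 * q + 1..<m + 1])
        (map (word_count D') [2 * q + 1..<m + 1])" if "D \<in> ?C" "D' \<in> ?C" for D D'
    unfolding counts[OF that(1)] counts[OF that(2)] by (rule order)
  then show ?thesis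
    unfolding sequential_minimizers_def by blast
qed

end
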